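(* Let $f$, the norm $\|\cdot\|$, the fixed point algorithm $\mathcal A$, the operator $g$ and the constants $a_f,L_f,\mu_\rho$ satisfy the assumptions (Q) and (A) in the context. Consider the restart algorithm (Algorithm R) of the context for an initial condition $r_0\in V_f(\rho)\subseteq\mathrm{dom}(f)$ and an exit tolerance $\epsilon>0$. Then: (i) The number of calls to $\mathcal A_d$ is bounded; that is, $j_{\rm out}$ is finite. (ii) The number of iterations of $\mathcal A$ at each call of $\mathcal A_d$ is upper bounded by $\lceil4n_\rho\rceil$; that is, $m_{j+1}\le\lceil4n_\rho\rceil$ for all integers $0\le j\le j_{\rm out}$. (iii) The total number of iterations of $\mathcal A$ required to attain the exit condition $f(r_{j_{\rm out}})-f(r_{j_{\rm out}+1})\le\epsilon$ is upper bounded by $$k_{\rm out}=\sum_{j=0}^{j_{\rm out}}m_{j+1}\le\frac{e\lceil4n_\rho\rceil}{2}\left\lceil5+\frac{1}{\log15}\log\left(1+\frac{f(r_0)-f^*}{\epsilon}\right)\right\rceil .$$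
   Context: $\|\cdot\|$ is a vector norm on $\mathbb R^{n_z}$ and $\|x\|_*=\sup\{\langle x,z\rangle:\|z\|\le1\}$ its dual norm. $e$ is Euler's number, $\log$ the natural logarithm. Problem: $f^*=\min_{z\in\mathbb R^{n_z}}f(z)$, where $f:\mathbb R^{n_z}\to\mathbb R\cup\{\pm\infty\}$ is proper closed convex and the problem is solvable; $\Omega_f$ is its set of minimizers, $\pi_{\Omega_f}$ the (Euclidean) projection onto $\Omega_f$, and $V_f(\rho)=\{z: f(z)-f^*\le\rho\}$ for $\rho\ge0$. Assumption (Q): for every $\rho\ge0$ there is $\mu_\rho>0$ with $f(z)-f^*\ge\frac{\mu_\rho}{2}\|z-\pi_{\Omega_f}(z)\|^2$ for all $z\in V_f(\rho)$. $\mathcal A$ is an iterative algorithm for the problem; $\mathcal A_k(z_0)\in\mathbb R^{n_z}$ denotes its $k$-th iterate when started at $z_0$. Assumption (A): there are $a_f>0$, $L_f>0$ and a gradient operator $g:\mathbb R^{n_z}\to\mathbb R^{n_z}$ with $g(z)=0\iff z\in\Omega_f$, such that for every $z_0\in\mathrm{dom}(f)$: $f(\mathcal A_k(z_0))-f^*\le\frac{a_f}{(k+1)^2}\|z_0-\pi_{\Omega_f}(z_0)\|^2$ for all $k\ge1$, and $f(\mathcal A_1(z_0))\le f(z_0)-\frac{1}{2L_f}\|g(z_0)\|_*^2$. $n_\rho=\max\left\{\frac12,\sqrt{\frac{2a_f}{\mu_\rho}}\right\}$. Algorithm $\mathcal A_d$ (delayed exit condition): given $z_0\in\mathrm{dom}(f)$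 and $n\in\mathbb R$, for $k=1,2,\dots$ set $z_k=\mathcal A_k(z_0)$ if $f(\mathcal A_k(z_0))\le f(z_{k-1})$ and $z_k=z_{k-1}$ otherwise, set $\ell=\lfloor k/2\rfloor$, and stop at the first $k$ with $k\ge n$ and $f(z_\ell)-f(z_k)\le\frac13(f(z_0)-f(z_\ell))$. Output $[z_m,m]=\mathcal A_d(z_0,n)$ with $m$ the final $k$. Algorithm R: given $r_0\in\mathrm{dom}(f)$, $\epsilon>0$, set $m_0=1$, $m_{-1}=1$, $j=-1$, $k=0$. Repeat: $j\leftarrow j+1$; $s_j\leftarrow\sqrt{\frac{f(r_{j-1})-f(r_j)}{f(r_{j-2})-f(r_j)}}$ if $j\ge2$ and $s_j\leftarrow0$ otherwise; $n_j\leftarrow\max\{m_j,4s_jm_{j-1}\}$; $[r_{j+1},m_{j+1}]\leftarrow\mathcal A_d(r_j,n_j)$; $k\leftarrow k+m_{j+1}$; until $f(r_j)-f(r_{j+1})\le\epsilon$. Outputs: $r_{\rm out}=r_{j+1}$, $j_{\rm out}=j$, $k_{\rm out}=k$. *)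

theory Defs
  imports "HOL-Analysis.Analysis"
begin

definition is_norm :: "('v::real_vector \<Rightarrow> real) \<Rightarrow> bool" where
  "is_norm N \<longleftrightarrow>
     (\<forall>x. 0 \<le> N x) \<and> (\<forall>x. N x = 0 \<longleftrightarrow> x = 0) \<and>
     (\<forall>c x. N (c *\<^sub>R x) = \<bar>c\<bar> * N x) \<and> (\<forall>x y. N (x + y) \<le> N x + N y)"

definition dual_norm :: "('v::real_inner \<Rightarrow> real) \<Rightarrow> 'v \<Rightarrow> real" where
  "dual_norm N x = (SUP z\<in>{z. N z \<le> 1}. x \<bullet> z)"

subsection \<open>Extended-real-valued convex functions\<close>

definition ereal_epigraph :: "('v \<Rightarrow> ereal) \<Rightarrow> ('v \<times> real) set" where
  "ereal_epigraph f = {(z, t). f z \<le> ereal t}"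

definition proper_fun :: "('v \<Rightarrow> ereal) \<Rightarrow> bool" where
  "proper_fun f \<longleftrightarrow> (\<forall>z. f z \<noteq> -\<infinity>) \<and> (\<exists>z. f z \<noteq> \<infinity>)"

definition closed_fun :: "('v::topological_space \<Rightarrow> ereal) \<Rightarrow> bool" where
  "closed_fun f \<longleftrightarrow> closed (ereal_epigraph f)"

definition convex_fun :: "('v::real_vector \<Rightarrow> ereal) \<Rightarrow> bool" where
  "convex_fun f \<longleftrightarrow> convex (ereal_epigraph f)"

definition eff_dom :: "('v \<Rightarrow> ereal) \<Rightarrow> 'v set" where
  "eff_dom f = {z. f z < \<infinity>}"

definition minimizers :: "('v \<Rightarrow> ereal) \<Rightarrow> 'v set" where
  "minimizers f = {z. \<forall>y. f z \<le> f y}"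

definition opt_val :: "('v \<Rightarrow> ereal) \<Rightarrow> ereal" where
  "opt_val f = (INF z. f z)"

definition sublevel :: "('v \<Rightarrow> ereal) \<Rightarrow> real \<Rightarrow> 'v set" where
  "sublevel f \<rho> = {z. f z - opt_val f \<le> ereal \<rho>}"

text \<open>The projection is the Euclidean one, whereas the distance to it is measured in the
  given norm \<open>N\<close>.\<close>

definition dist_opt :: "('v::{real_inner,heine_borel} \<Rightarrow> real) \<Rightarrow> ('v \<Rightarrow> ereal) \<Rightarrow> 'v \<Rightarrow> real" where
  "dist_opt N f z = N (z - closest_point (minimizers f) z)"

subsection \<open>Assumptions\<close>

definition quadratic_growth ::
    "('v::{real_inner,heine_borel} \<Rightarrow> real) \<Rightarrow> ('v \<Rightarrow> ereal) \<Rightarrow> (real \<Rightarrow> real) \<Rightarrow> bool" where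
  "quadratic_growth N f \<mu> \<longleftrightarrow>
     (\<forall>\<rho>\<ge>0. \<mu> \<rho> > 0 \<and>
        (\<forall>z\<in>sublevel f \<rho>. f z - opt_val f \<ge> ereal (\<mu> \<rho> / 2 * (dist_opt N f z)\<^sup>2)))"

definition algorithm_assumption ::
    "('v::{real_inner,heine_borel} \<Rightarrow> real) \<Rightarrow> ('v \<Rightarrow> ereal) \<Rightarrow> (nat \<Rightarrow> 'v \<Rightarrow> 'v)
      \<Rightarrow> ('v \<Rightarrow> 'v) \<Rightarrow> real \<Rightarrow> real \<Rightarrow> bool" where
  "algorithm_assumption N f A g a L \<longleftrightarrow>
     a > 0 \<and> L > 0 \<and> (\<forall>z. g z = 0 \<longleftrightarrow> z \<in> minimizers f) \<and>
     (\<forall>z0\<in>eff_dom f.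
        (\<forall>k\<ge>1. f (A k z0) - opt_val f \<le> ereal (a / (real k + 1)\<^sup>2 * (dist_opt N f z0)\<^sup>2)) \<and>
        f (A 1 z0) \<le> f z0 - ereal (1 / (2 * L) * (dual_norm N (g z0))\<^sup>2))"

definition n_bound :: "real \<Rightarrow> (real \<Rightarrow> real) \<Rightarrow> real \<Rightarrow> real" where
  "n_bound a \<mu> \<rho> = max (1/2) (sqrt (2 * a / \<mu> \<rho>))"

subsection \<open>The algorithm with delayed exit condition\<close>

primrec delayed_iter :: "('v \<Rightarrow> ereal) \<Rightarrow> (nat \<Rightarrow> 'v \<Rightarrow> 'v) \<Rightarrow> 'v \<Rightarrow> nat \<Rightarrow> 'v" where
  "delayed_iter f A z0 0 = z0"
| "delayed_iter f A z0 (Suc k) =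
     (if f (A (Suc k) z0) \<le> f (delayed_iter f A z0 k) then A (Suc k) z0
      else delayed_iter f A z0 k)"

definition delayed_exit ::
    "('v \<Rightarrow> ereal) \<Rightarrow> (nat \<Rightarrow> 'v \<Rightarrow> 'v) \<Rightarrow> 'v \<Rightarrow> real \<Rightarrow> nat \<Rightarrow> bool" where
  "delayed_exit f A z0 n k \<longleftrightarrow>
     1 \<le> k \<and> n \<le> real k \<and>
     (let z = delayed_iter f A z0; l = k div 2
      in f (z l) - f (z k) \<le> ereal (1/3) * (f z0 - f (z l)))"

text \<open>The output \<open>(z\<^sub>m, m)\<close>; \<open>None\<close> means that the exit condition is never met.\<close>

definition delayed_alg ::
    "('v \<Rightarrow> ereal) \<Rightarrow> (nat \<Rightarrow> 'v \<Rightarrow> 'v) \<Rightarrow> 'v \<Rightarrow> real \<Rightarrow> ('v \<times> nat) option" where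
  "delayed_alg f A z0 n =
     (if \<exists>k. delayed_exit f A z0 n k
      then let m = (LEAST k. delayed_exit f A z0 n k) in Some (delayed_iter f A z0 m, m)
      else None)"

subsection \<open>The restart algorithm\<close>

text \<open>The variables \<open>j\<close>, \<open>k\<close>, \<open>r\<close>, \<open>m\<close> of the algorithm. The sequences are integer-indexed because
  \<open>m\<^bsub>-1\<^esub>\<close> occurs and \<open>j\<close> starts at \<open>-1\<close>. The constant functions in \<open>restart_init\<close> set
  \<open>r\<^sub>0\<close> and \<open>m\<^bsub>-1\<^esub> = m\<^sub>0 = 1\<close>; no other entry influences the run before it is assigned.\<close>

record 'v restart_state =
  idx :: int
  total_iters :: nat
  point :: "int \<Rightarrow> 'v"
  call_iters :: "int \<Rightarrow> nat"

definition restart_init :: "'v \<Rightarrow> 'v restart_state" where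
  "restart_init r0 = \<lparr>idx = -1, total_iters = 0, point = (\<lambda>_. r0), call_iters = (\<lambda>_. 1)\<rparr>"

definition restart_s :: "('v \<Rightarrow> ereal) \<Rightarrow> (int \<Rightarrow> 'v) \<Rightarrow> int \<Rightarrow> real" where
  "restart_s f r j =
     (if j \<ge> 2
      then sqrt (real_of_ereal (f (r (j-1)) - f (r j)) / real_of_ereal (f (r (j-2)) - f (r j)))
      else 0)"

definition restart_body ::
    "('v \<Rightarrow> ereal) \<Rightarrow> (nat \<Rightarrow> 'v \<Rightarrow> 'v) \<Rightarrow> 'v restart_state \<Rightarrow> 'v restart_state option" where
  "restart_body f A S =
     (let j = idx S + 1; r = point S; m = call_iters S;
          n = max (real (m j)) (4 * restart_s f r j * real (m (j-1)))
      in map_option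
           (\<lambda>(z, m'). \<lparr>idx = j, total_iters = total_iters S + m', point = r(j+1 := z), call_iters = m(j+1 := m')\<rparr>)
           (delayed_alg f A (r j) n))"

definition restart_exit :: "('v \<Rightarrow> ereal) \<Rightarrow> real \<Rightarrow> 'v restart_state \<Rightarrow> bool" where
  "restart_exit f \<epsilon> S \<longleftrightarrow> f (point S (idx S)) - f (point S (idx S + 1)) \<le> ereal \<epsilon>"

text \<open>The repeat-until loop. As the least fixed point in the option type, the result is \<open>None\<close>
  exactly if the loop runs forever or one of the inner calls does not terminate.\<close>

partial_function (option) restart_loop ::
    "('v \<Rightarrow> ereal) \<Rightarrow> (nat \<Rightarrow> 'v \<Rightarrow> 'v) \<Rightarrow> real \<Rightarrow> 'v restart_state \<Rightarrow> 'v restart_state option" where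
  "restart_loop f A \<epsilon> S =
     Option.bind (restart_body f A S)
       (\<lambda>S'. if restart_exit f \<epsilon> S' then Some S' else restart_loop f A \<epsilon> S')"

definition restart_alg ::
    "('v \<Rightarrow> ereal) \<Rightarrow> (nat \<Rightarrow> 'v \<Rightarrow> 'v) \<Rightarrow> real \<Rightarrow> 'v \<Rightarrow> 'v restart_state option" where
  "restart_alg f A \<epsilon> r0 = restart_loop f A \<epsilon> (restart_init r0)"

end

theory Submission
  imports Defs
begin

text \<open>
  Write \<open>F\<close> for \<open>f - f*\<close> and \<open>\<nu>\<close> for \<open>n\<^sub>\<rho>\<close>. Quadratic growth and the sublinear rate of the
  algorithm combine to \<open>F (A\<^sub>k z) \<le> (\<nu> / (k + 1))\<^sup>2 F z\<close> on the sublevel set, and the whole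
  argument rests on this inequality (locale \<open>sublevel_rate\<close>).

  \<^emph>\<open>One call.\<close> The delayed exit condition holds at \<open>k = \<lceil>4\<nu>\<rceil>\<close>: the rate at \<open>l = \<lfloor>k/2\<rfloor>\<close> gives
  \<open>F z\<^sub>l \<le> F z\<^sub>0 / 4\<close>. Hence a call returns after at most \<open>\<lceil>4\<nu>\<rceil>\<close> steps, provided that the prescribed
  minimum \<open>n\<^sub>j\<close> is itself at most \<open>\<lceil>4\<nu>\<rceil>\<close>. It is: \<open>m\<^sub>j\<close> is so bounded by induction, and \<open>4 s\<^sub>j m\<^bsub>j-1\<^esub>\<close> because
  \<open>s\<^sub>j\<^sup>2 \<le> F r\<^bsub>j-1\<^esub> / F r\<^bsub>j-2\<^esub> \<le> (\<nu> / (m\<^bsub>j-1\<^esub> + 1))\<^sup>2\<close> (lemma \<open>restart_s_bound\<close>). Each call but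
  the last lowers \<open>F \<ge> 0\<close> by more than \<open>\<epsilon>\<close>, so there are finitely many.

  \<^emph>\<open>The total.\<close> Number the calls from \<open>0\<close>, let \<open>h\<^sub>j = m\<^bsub>j+1\<^esub>\<close> be the length of call \<open>j\<close> and
  \<open>x\<^sub>j = f r\<^sub>j - f r\<^bsub>j+1\<^esub>\<close> its decrease. The choice of \<open>n\<^sub>j\<close> says that \<open>h\<close> is nondecreasing and that
  \<open>q = (h\<^bsub>j+2\<^esub> / h\<^sub>j)\<^sup>2\<close> satisfies \<open>q (1 + x\<^sub>j / x\<^bsub>j+1\<^esub>) \<ge> 16\<close>. For \<open>1 \<le> q \<le> 15\<close> this implies
  \<open>q\<^sup>2 x\<^sub>j / x\<^bsub>j+1\<^esub> \<ge> 15\<close>, since \<open>q (16 - q) - 15 = (q - 1) (15 - q) \<ge> 0\<close>. The last inequality telescopes: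
  over \<open>p\<close> consecutive indices the quotients \<open>x\<^sub>j / x\<^bsub>j+1\<^esub>\<close> multiply to less than \<open>F r\<^sub>0 / \<epsilon>\<close>, so the
  lengths must grow. Quantitatively, they grow by a factor \<open>\<surd>15\<close> within any \<open>D\<close> calls, where
  \<open>D = \<lceil>5 + log\<^bsub>15\<^esub> (1 + F r\<^sub>0 / \<epsilon>)\<rceil>\<close> (lemma \<open>growth_lag\<close>). Cutting the run into blocks of \<open>D\<close> calls,
  counted from the end, bounds the total by a geometric series of sum
  \<open>D \<lceil>4\<nu>\<rceil> \<surd>15 / (\<surd>15 - 1)\<close>, and \<open>\<surd>15 / (\<surd>15 - 1) \<le> e / 2\<close>.
\<close>

section \<open>Growth of the iteration counts\<close>

text \<open>In terms of \<open>q = (h2 / h0)\<^sup>2\<close>: if \<open>1 \<le> q \<le> 15\<close> and \<open>q (1 + x0 / x1) \<ge> 16\<close>, then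
  \<open>q\<^sup>2 x0 / x1 \<ge> 15\<close>. Unlike its hypothesis, the conclusion is multiplicative along a run.\<close>

lemma growth_step:
  fixes h0 h2 x0 x1 :: real
  assumes "0 < h0" "h0 \<le> h2" "h2\<^sup>2 \<le> 15 * h0\<^sup>2" "0 < x1"
    and "16 * x1 * h0\<^sup>2 \<le> h2\<^sup>2 * (x0 + x1)"
  shows "15 * x1 * h0 ^ 4 \<le> h2 ^ 4 * x0"
proof -
  define p q where "p = h0\<^sup>2" and "q = h2\<^sup>2"
  have pq: "0 < p" "p \<le> q" "q \<le> 15 * p"
    using assms by (auto simp: p_def q_def power_mono)
  have "x1 * (16 * p - q) \<le> q * x0"
    using assms(5) by (simp add: p_def q_def algebra_simps)
  hence "q * (x1 * (16 * p - q)) \<le> q * (q * x0)"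
    using pq by (intro mult_left_mono) auto
  moreover have "0 \<le> x1 * ((q - p) * (15 * p - q))"
    using pq assms(4) by (intro mult_nonneg_nonneg) auto
  moreover have "x1 * ((q - p) * (15 * p - q)) = q * (x1 * (16 * p - q)) - 15 * x1 * p\<^sup>2"
    by (simp add: algebra_simps power2_eq_square)
  ultimately have "15 * x1 * p\<^sup>2 \<le> q\<^sup>2 * x0"
    by (simp add: power2_eq_square mult.assoc)
  thus ?thesis
    by (simp add: p_def q_def flip: power_mult)
qed

text \<open>The steps link \<open>h j\<close> to \<open>h (j + 2)\<close>, so the product over all \<open>j\<close> telescopes separately along
  even and odd indices and two factors remain at either end.\<close>

lemma growth_telescope:
  fixes h x :: "nat \<Rightarrow> real"
  assumes pos: "\<And>j. j \<le> i + p + 1 \<Longrightarrow> 0 < h j"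
    and step: "\<And>j. i \<le> j \<Longrightarrow> j < i + p \<Longrightarrow> 15 * x (Suc j) * h j ^ 4 \<le> h (j + 2) ^ 4 * x j"
  shows "15 ^ p * x (i + p) * (h i ^ 4 * h (i + 1) ^ 4)
    \<le> h (i + p) ^ 4 * h (i + p + 1) ^ 4 * x i"
  using assms
proof (induction p)
  case 0
  then show ?case by (simp add: mult_ac)
next
  case (Suc p)
  have pos: "0 < h (i + p)" "0 < h (i + p + 1)"
    using Suc.prems(1) by auto
  have "h (i + p) ^ 4 * (15 ^ Suc p * x (i + Suc p) * (h i ^ 4 * h (i + 1) ^ 4))
      = (15 ^ p * (h i ^ 4 * h (i + 1) ^ 4)) * (15 * x (Suc (i + p)) * h (i + p) ^ 4)"
    by (simp add: mult_ac)
  also have "\<dots> \<le> (15 ^ p * (h i ^ 4 * h (i + 1) ^ 4)) * (h (i + p + 2) ^ 4 * x (i + p))"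
    by (intro mult_left_mono Suc.prems(2)) auto
  also have "\<dots> = h (i + p + 2) ^ 4 * (15 ^ p * x (i + p) * (h i ^ 4 * h (i + 1) ^ 4))"
    by (simp add: mult_ac)
  also have "\<dots> \<le> h (i + p + 2) ^ 4 * (h (i + p) ^ 4 * h (i + p + 1) ^ 4 * x i)"
    using Suc.prems by (intro mult_left_mono Suc.IH) auto
  also have "\<dots> = h (i + p) ^ 4 * (h (i + Suc p) ^ 4 * h (i + Suc p + 1) ^ 4 * x i)"
    by (simp add: mult_ac)
  finally show ?case
    using pos by (simp only: mult_le_cancel_left_pos zero_less_power)
qed

text \<open>The indices \<open>j < J\<close> are the calls that do not meet the exit condition, hence \<open>\<epsilon> < x j\<close>; the
  bound \<open>G\<close> stands for the initial optimality gap.\<close>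

lemma growth_lag:
  fixes h x :: "nat \<Rightarrow> real"
  assumes mono: "\<And>j. j < J \<Longrightarrow> h j \<le> h (Suc j)"
    and pos: "\<And>j. j \<le> J \<Longrightarrow> 0 < h j"
    and step: "\<And>j. j + 2 \<le> J \<Longrightarrow> 16 * x (Suc j) * (h j)\<^sup>2 \<le> (h (j + 2))\<^sup>2 * (x j + x (Suc j))"
    and x: "\<And>j. j < J \<Longrightarrow> \<epsilon> < x j" "\<And>j. j \<le> J \<Longrightarrow> x j \<le> G"
    and "0 < \<epsilon>" and iJ: "i + p + 1 \<le> J"
    and large: "15 ^ 4 * (G / \<epsilon>) \<le> 15 ^ p"
  shows "sqrt 15 * h i \<le> h (i + p + 1)"
proof (rule ccontr)
  assume "\<not> ?thesis"
  hence lt: "h (i + p + 1) < sqrt 15 * h i" by simp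
  have hmono: "h j \<le> h k" if "j \<le> k" "k \<le> J" for j k
    using that
  proof (induction k rule: dec_induct)
    case (step k)
    then show ?case using mono[of k] by simp
  qed simp
  \<comment> \<open>If growth falls short of \<open>\<surd>15\<close>, then so do all ratios in between, and \<open>growth_step\<close> applies.\<close>
  have sq: "(h k)\<^sup>2 \<le> 15 * (h j)\<^sup>2" if "i \<le> j" "j \<le> k" "k \<le> i + p + 1" for j k
  proof -
    have "h k \<le> h (i + p + 1)" "h i \<le> h j" using that iJ by (auto intro!: hmono)
    moreover from this have "sqrt 15 * h i \<le> sqrt 15 * h j" by (intro mult_left_mono) auto
    ultimately have "h k \<le> sqrt 15 * h j" using lt by linarith
    hence "(h k)\<^sup>2 \<le> (sqrt 15 * h j)\<^sup>2"
      using pos[of k] that iJ by (intro power_mono) auto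
    thus ?thesis by (simp add: power_mult_distrib)
  qed
  have tele: "15 ^ p * x (i + p) * (h i ^ 4 * h (i + 1) ^ 4)
      \<le> h (i + p) ^ 4 * h (i + p + 1) ^ 4 * x i"
  proof (rule growth_telescope)
    fix j assume j: "i \<le> j" "j < i + p"
    show "15 * x (Suc j) * h j ^ 4 \<le> h (j + 2) ^ 4 * x j"
    proof (rule growth_step)
      show "0 < x (Suc j)" using x(1)[of "Suc j"] \<open>0 < \<epsilon>\<close> j iJ by simp
    next
      show "16 * x (Suc j) * (h j)\<^sup>2 \<le> (h (j + 2))\<^sup>2 * (x j + x (Suc j))"
        using j iJ by (intro step) auto
    qed (use j iJ in \<open>auto intro!: pos hmono sq\<close>)
  qed (use iJ pos in auto)
  have xi: "0 < x i" "x i \<le> G" and xp: "\<epsilon> < x (i + p)"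
    using x(1)[of i] x(2)[of i] x(1)[of "i + p"] \<open>0 < \<epsilon>\<close> iJ by auto
  have hi: "0 < h i" "0 < h (i + 1)" "0 < h (i + p)" using pos iJ by auto
  \<comment> \<open>The two ratios left after telescoping contribute \<open>15\<^sup>2\<close> each, whence the \<open>15 ^ 4\<close> in \<open>large\<close>.\<close>
  have four: "h (i + p) ^ 4 \<le> 15\<^sup>2 * h i ^ 4" "h (i + p + 1) ^ 4 \<le> 15\<^sup>2 * h (i + 1) ^ 4"
  proof -
    have "((h (i + p))\<^sup>2)\<^sup>2 \<le> (15 * (h i)\<^sup>2)\<^sup>2" "((h (i + p + 1))\<^sup>2)\<^sup>2 \<le> (15 * (h (i + 1))\<^sup>2)\<^sup>2"
      by (intro power_mono sq; simp)+
    thus "h (i + p) ^ 4 \<le> 15\<^sup>2 * h i ^ 4" "h (i + p + 1) ^ 4 \<le> 15\<^sup>2 * h (i + 1) ^ 4"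
      by (simp_all add: power_mult_distrib flip: power_mult)
  qed
  have "15 ^ 4 * G * (h i ^ 4 * h (i + 1) ^ 4)
      = 15 ^ 4 * (G / \<epsilon>) * \<epsilon> * (h i ^ 4 * h (i + 1) ^ 4)"
    using \<open>0 < \<epsilon>\<close> by simp
  also have "\<dots> \<le> 15 ^ p * \<epsilon> * (h i ^ 4 * h (i + 1) ^ 4)"
    using large \<open>0 < \<epsilon>\<close> by (intro mult_right_mono) auto
  also have "\<dots> < 15 ^ p * x (i + p) * (h i ^ 4 * h (i + 1) ^ 4)"
    using xp hi by (intro mult_strict_right_mono) auto
  also have "\<dots> \<le> h (i + p) ^ 4 * h (i + p + 1) ^ 4 * x i"
    by (fact tele)
  also have "\<dots> \<le> (15\<^sup>2 * h i ^ 4) * (15\<^sup>2 * h (i + 1) ^ 4) * G"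
    using four xi hi by (intro mult_mono) auto
  finally show False by simp
qed

text \<open>Blocks of \<open>D\<close> terms, taken from the end, are dominated by \<open>D B\<close>, \<open>D B / c\<close>, \<open>D B / c\<^sup>2\<close>, \<open>\<dots>\<close>.\<close>

lemma lagged_geometric_sum:
  fixes h :: "nat \<Rightarrow> real"
  assumes "1 < c" "0 < D" "0 \<le> B"
    and "\<And>i. i < n \<Longrightarrow> h i \<le> B"
    and "\<And>i. i + D < n \<Longrightarrow> c * h i \<le> h (i + D)"
  shows "(\<Sum>i<n. h i) \<le> real D * B * (c / (c - 1))"
  using assms(3-5)
proof (induction n arbitrary: B rule: less_induct)
  case (less n B)
  have c: "c / (c - 1) = 1 + (1 / c) * (c / (c - 1))"
    using \<open>1 < c\<close> by (simp add: field_simps)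
  show ?case
  proof (cases "n \<le> D")
    case True
    have "(\<Sum>i<n. h i) \<le> real n * B"
      using sum_bounded_above[of "{..<n}" h B] less.prems by simp
    also have "\<dots> \<le> real D * B"
      using True less.prems by (intro mult_right_mono) auto
    also have "\<dots> \<le> real D * B * (c / (c - 1))"
      using mult_left_mono[of 1 "c / (c - 1)" "real D * B"] \<open>1 < c\<close> less.prems by simp
    finally show ?thesis .
  next
    case False
    have "(\<Sum>i<n - D. h i) \<le> real D * (B / c) * (c / (c - 1))"
    proof (rule less.IH)
      fix i assume "i < n - D"
      hence "c * h i \<le> B"
        using less.prems(2)[of "i + D"] less.prems(3)[of i] by (simp add: less_diff_conv)
      thus "h i \<le> B / c" using \<open>1 < c\<close> by (simp add: field_simps)
    qed (use False \<open>0 < D\<close> \<open>1 < c\<close> less.prems in auto)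
    moreover have "(\<Sum>i=n - D..<n. h i) \<le> real D * B"
      using sum_bounded_above[of "{n - D..<n}" h B] less.prems False by simp
    moreover have "(\<Sum>i<n. h i) = (\<Sum>i<n - D. h i) + (\<Sum>i=n - D..<n. h i)"
      using sum.atLeastLessThan_concat[of 0 "n - D" n h] False
      by (simp add: atLeast0LessThan)
    ultimately have "(\<Sum>i<n. h i) \<le> real D * B + real D * (B / c) * (c / (c - 1))"
      by linarith
    also have "\<dots> = real D * B * (1 + (1 / c) * (c / (c - 1)))"
      by (simp only: distrib_left mult_1_right mult.assoc divide_inverse mult_1_left)
    finally show ?thesis unfolding c[symmetric] .
  qed
qed

lemma sqrt15_ratio_le: "sqrt 15 / (sqrt 15 - 1) \<le> exp 1 / (2::real)"
proof -
  \<comment> \<open>The two sides are about \<open>1.3481\<close> and \<open>1.3591\<close>.\<close>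
  have s: "sqrt 15 \<ge> (387/100::real)" by (intro real_le_rsqrt) (simp add: power2_eq_square)
  have "(\<Sum>k<5. 1 ^ k / fact k) \<le> exp (1::real)"
    using sum_le_suminf[OF summable_exp_generic[of "1::real"], of "{..<5}"]
    by (simp add: exp_def divide_inverse)
  hence e: "(27/10::real) \<le> exp 1" by (simp add: eval_nat_numeral)
  have "sqrt 15 / (sqrt 15 - 1) = 1 + 1 / (sqrt 15 - 1 :: real)"
    using s by (simp add: field_simps)
  also have "\<dots> \<le> 1 + 1 / (287/100)"
    using s by (intro add_left_mono divide_left_mono) auto
  finally show ?thesis using e by simp
qed

lemma iteration_sum_bound:
  fixes h x :: "nat \<Rightarrow> real"
  assumes mono: "\<And>j. j < J \<Longrightarrow> h j \<le> h (Suc j)"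
    and pos: "\<And>j. j \<le> J \<Longrightarrow> 0 < h j"
    and le: "\<And>j. j \<le> J \<Longrightarrow> h j \<le> B"
    and step: "\<And>j. j + 2 \<le> J \<Longrightarrow> 16 * x (Suc j) * (h j)\<^sup>2 \<le> (h (j + 2))\<^sup>2 * (x j + x (Suc j))"
    and x: "\<And>j. j < J \<Longrightarrow> \<epsilon> < x j" "\<And>j. j \<le> J \<Longrightarrow> x j \<le> G"
    and "0 < \<epsilon>" "0 \<le> G"
  shows "(\<Sum>j\<le>J. h j) \<le> exp 1 * B / 2 * real_of_int \<lceil>5 + 1 / ln 15 * ln (1 + G / \<epsilon>)\<rceil>"
proof -
  \<comment> \<open>The lag of \<open>growth_lag\<close> is \<open>p + 1\<close>, so \<open>p\<close> is one less than the number of calls in a block.\<close>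
  define T where "T = 1 / ln 15 * ln (1 + G / \<epsilon>)"
  define p where "p = nat \<lceil>4 + T\<rceil>"
  have Q: "0 \<le> G / \<epsilon>" using assms by simp
  have T: "0 \<le> T" using Q by (simp add: T_def)
  hence D: "real (p + 1) = real_of_int \<lceil>5 + T\<rceil>"
  proof -
    have "\<lceil>5 + T\<rceil> = \<lceil>4 + T\<rceil> + 1" by linarith
    thus ?thesis using T by (simp add: p_def)
  qed
  have "ln (1 + G / \<epsilon>) = T * ln 15" by (simp add: T_def)
  hence "1 + G / \<epsilon> = 15 powr T"
    using Q by (simp add: powr_def flip: \<open>ln (1 + G / \<epsilon>) = T * ln 15\<close>)
  hence "15 ^ 4 * (G / \<epsilon>) \<le> 15 powr 4 * 15 powr T"
    by (simp add: powr_numeral)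
  also have "\<dots> = 15 powr (4 + T)" by (simp add: powr_add)
  also have "\<dots> \<le> 15 powr p"
    using T unfolding p_def by (intro powr_mono) linarith+
  finally have large: "15 ^ 4 * (G / \<epsilon>) \<le> 15 ^ p" by (simp add: powr_realpow)
  have B: "0 \<le> B" using pos[of 0] le[of 0] by simp
  have "(\<Sum>j\<le>J. h j) = (\<Sum>j<Suc J. h j)"
    by (simp add: lessThan_Suc_atMost)
  also have "\<dots> \<le> real (p + 1) * B * (sqrt 15 / (sqrt 15 - 1))"
  proof (rule lagged_geometric_sum)
    fix i assume "i + (p + 1) < Suc J"
    hence "sqrt 15 * h i \<le> h (i + p + 1)"
      by (intro growth_lag[where J = J and x = x and \<epsilon> = \<epsilon> and G = G] assms large) auto
    thus "sqrt 15 * h i \<le> h (i + (p + 1))" by simp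
  qed (use le B in auto)
  also have "\<dots> \<le> real (p + 1) * B * (exp 1 / 2)"
    using B by (intro mult_left_mono sqrt15_ratio_le) auto
  finally show ?thesis unfolding D T_def by (simp add: mult_ac)
qed

section \<open>A single run of the inner algorithm\<close>

text \<open>An algorithm with rate \<open>(\<nu> / (k + 1))\<^sup>2\<close> relative to the initial gap, on the sublevel set of height
  \<open>\<rho>\<close> above a lower bound \<open>c\<close> of \<open>f\<close>. The rate is stated with \<open>\<nu>\<^sup>2\<close> so that \<open>\<nu>\<close> can be \<open>n_bound\<close>.\<close>

locale sublevel_rate =
  fixes f :: "'v \<Rightarrow> ereal" and A :: "nat \<Rightarrow> 'v \<Rightarrow> 'v" and c \<nu> \<rho> :: real
  assumes lower: "ereal c \<le> f z"
    and nu_ge: "1/2 \<le> \<nu>"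
    and rate: "f z \<le> ereal (c + \<rho>) \<Longrightarrow> 1 \<le> k \<Longrightarrow>
      f (A k z) \<le> ereal (c + \<nu>\<^sup>2 / (real k + 1)\<^sup>2 * (real_of_ereal (f z) - c))"
begin

text \<open>The real number \<open>f z - c\<close>; it is used only where \<open>f z\<close> is finite, as \<open>value_eq\<close> guarantees
  below any finite level.\<close>

definition gap :: "'v \<Rightarrow> real" where
  "gap z = real_of_ereal (f z) - c"

lemma value_eq: "f z \<le> ereal y \<Longrightarrow> f z = ereal (c + gap z)"
  using lower[of z] by (cases "f z") (auto simp: gap_def)

lemma gap_nonneg: "f z \<le> ereal y \<Longrightarrow> 0 \<le> gap z"
  using lower[of z] by (cases "f z") (auto simp: gap_def)

lemma delayed_iter_antimono: "i \<le> k \<Longrightarrow> f (delayed_iter f A z k) \<le> f (delayed_iter f A z i)"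
  by (induction k rule: dec_induct) auto

lemma delayed_iter_le: "1 \<le> k \<Longrightarrow> f (delayed_iter f A z k) \<le> f (A k z)"
  by (cases k) auto

lemma delayed_iter_le_start: "f (delayed_iter f A z k) \<le> f z"
  using delayed_iter_antimono[of 0 k z] by simp

lemma delayed_iter_rate:
  assumes z: "f z \<le> ereal (c + \<rho>)" and k: "1 \<le> k"
  shows "gap (delayed_iter f A z k) \<le> \<nu>\<^sup>2 / (real k + 1)\<^sup>2 * gap z"
proof -
  have "f (delayed_iter f A z k) \<le> ereal (c + \<nu>\<^sup>2 / (real k + 1)\<^sup>2 * gap z)"
    using delayed_iter_le[OF k] rate[OF z k] unfolding gap_def by (rule order_trans)
  from this value_eq[OF this] show ?thesis by simp
qed

text \<open>The exit condition reads \<open>4 F z\<^sub>l - 3 F z\<^sub>k \<le> F z\<^sub>0\<close>, so \<open>F z\<^sub>l \<le> F z\<^sub>0 / 4\<close> suffices. The hypothesis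
  \<open>\<nu> \<ge> 1/2\<close> is what makes \<open>l \<ge> 1\<close>, where the rate applies.\<close>

lemma delayed_exit_at_bound:
  assumes z: "f z \<le> ereal (c + \<rho>)" and n: "n \<le> real_of_int \<lceil>4 * \<nu>\<rceil>"
  shows "delayed_exit f A z n (nat \<lceil>4 * \<nu>\<rceil>)"
proof -
  define k l where "k = nat \<lceil>4 * \<nu>\<rceil>" and "l = k div 2"
  have k: "4 * \<nu> \<le> real k" "n \<le> real k" "2 \<le> k"
    using nu_ge n unfolding k_def by linarith+
  have l: "1 \<le> l" "2 * \<nu> \<le> real l + 1"
    using k unfolding l_def by linarith+
  let ?z = "delayed_iter f A z"
  have fin: "f (?z i) \<le> ereal (c + \<rho>)" for i
    using delayed_iter_le_start z by (rule order_trans)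
  have "(2 * \<nu>)\<^sup>2 \<le> (real l + 1)\<^sup>2"
    using l nu_ge by (intro power_mono) auto
  hence "\<nu>\<^sup>2 / (real l + 1)\<^sup>2 \<le> 1 / 4"
    by (simp add: divide_le_eq power_mult_distrib)
  hence "\<nu>\<^sup>2 / (real l + 1)\<^sup>2 * gap z \<le> 1 / 4 * gap z"
    by (rule mult_right_mono) (rule gap_nonneg[OF z])
  with delayed_iter_rate[OF z l(1)] have "gap (?z l) \<le> gap z / 4"
    by linarith
  hence "gap (?z l) - gap (?z k) \<le> 1/3 * (gap z - gap (?z l))"
    using gap_nonneg[OF fin[of k]] by simp
  hence "f (?z l) - f (?z k) \<le> ereal (1/3) * (f z - f (?z l))"
    using value_eq[OF z] value_eq[OF fin[of l]] value_eq[OF fin[of k]] by simp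
  thus ?thesis
    using k by (simp add: delayed_exit_def Let_def k_def[symmetric] l_def[symmetric])
qed

lemma delayed_alg_terminates:
  assumes z: "f z \<le> ereal (c + \<rho>)" and n: "n \<le> real_of_int \<lceil>4 * \<nu>\<rceil>"
  obtains z' m where "delayed_alg f A z n = Some (z', m)" "1 \<le> m" "n \<le> real m"
    "int m \<le> \<lceil>4 * \<nu>\<rceil>" "f z' \<le> f z" "gap z' \<le> \<nu>\<^sup>2 / (real m + 1)\<^sup>2 * gap z"
proof -
  define m where "m = (LEAST k. delayed_exit f A z n k)"
  note ex = delayed_exit_at_bound[OF z n]
  have m: "delayed_exit f A z n m" unfolding m_def using ex by (rule LeastI)
  have le: "m \<le> nat \<lceil>4 * \<nu>\<rceil>" unfolding m_def using ex by (rule Least_le)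
  have m1: "1 \<le> m" "n \<le> real m" using m by (auto simp: delayed_exit_def)
  show ?thesis
  proof (rule that)
    show "delayed_alg f A z n = Some (delayed_iter f A z m, m)"
      using ex by (auto simp: delayed_alg_def m_def Let_def)
    show "int m \<le> \<lceil>4 * \<nu>\<rceil>" using le m1 by linarith
  qed (use m1 delayed_iter_le_start delayed_iter_rate[OF z] in auto)
qed

section \<open>The restart loop\<close>

text \<open>The properties of call \<open>j\<close>, which leads from \<open>r j\<close> to \<open>r (j+1)\<close> in \<open>m (j+1)\<close> iterations.\<close>

definition valid_call :: "(int \<Rightarrow> 'v) \<Rightarrow> (int \<Rightarrow> nat) \<Rightarrow> int \<Rightarrow> bool" where
  "valid_call r m j \<longleftrightarrow>
     1 \<le> m (j+1) \<and> m j \<le> m (j+1) \<and> 4 * restart_s f r j * real (m (j-1)) \<le> real (m (j+1)) \<and>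
     int (m (j+1)) \<le> \<lceil>4 * \<nu>\<rceil> \<and> gap (r (j+1)) \<le> \<nu>\<^sup>2 / (real (m (j+1)) + 1)\<^sup>2 * gap (r j)"

text \<open>The invariant of the restart loop, for a state in which the calls \<open>0, \<dots>, idx S\<close> are complete.
  The decrease exceeds \<open>\<epsilon>\<close> only for \<open>j < idx S\<close>, because the exit test for the last of these calls may
  have succeeded. For the initial state, where \<open>idx S = -1\<close>, the ranges for completed calls are
  empty.\<close>

definition valid_run :: "'v \<Rightarrow> real \<Rightarrow> 'v restart_state \<Rightarrow> bool" where
  "valid_run r0 \<epsilon> S \<longleftrightarrow>
     -1 \<le> idx S \<and> point S 0 = r0 \<and> call_iters S 0 = 1 \<and>
     (\<forall>j\<in>{0..idx S}. valid_call (point S) (call_iters S) j) \<and>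
     (\<forall>j\<in>{0..idx S + 1}. f (point S j) \<le> f r0) \<and>
     (\<forall>j\<in>{0..<idx S}. \<epsilon> < gap (point S j) - gap (point S (j+1))) \<and>
     total_iters S = (\<Sum>j\<in>{0..idx S}. call_iters S (j+1))"

lemma valid_call_upd:
  "j < k \<Longrightarrow> valid_call (r(k+1 := z)) (m(k+1 := n)) j \<longleftrightarrow> valid_call r m j"
  by (simp add: valid_call_def restart_s_def)

lemma restart_s_eq:
  assumes "f (r (j-2)) \<le> ereal y" "f (r (j-1)) \<le> ereal y" "f (r j) \<le> ereal y" "2 \<le> j"
  shows "restart_s f r j
    = sqrt ((gap (r (j-1)) - gap (r j)) / (gap (r (j-2)) - gap (r j)))"
  using assms by (simp add: restart_s_def value_eq[OF assms(1)] value_eq[OF assms(2)]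
      value_eq[OF assms(3)])

text \<open>Subtracting \<open>gap (r j)\<close> from numerator and denominator only decreases the ratio
  \<open>gap (r (j-1)) / gap (r (j-2))\<close>, which the rate of call \<open>j-2\<close> bounds. Therefore the minimum length
  prescribed for call \<open>j\<close> never exceeds \<open>4\<nu>\<close> on this account.\<close>

lemma restart_s_bound:
  assumes fin: "f (r (j-2)) \<le> ereal y" "f (r (j-1)) \<le> ereal y" "f (r j) \<le> ereal y"
    and "2 \<le> j" and prev: "valid_call r m (j-2)"
    and dec: "gap (r (j-1)) < gap (r (j-2))" "gap (r j) < gap (r (j-1))"
  shows "4 * restart_s f r j * real (m (j-1)) \<le> 4 * \<nu>"
proof -
  define G0 G1 G2 where "G0 = gap (r (j-2))" and "G1 = gap (r (j-1))" and "G2 = gap (r j)"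
  define q where "q = real (m (j-1)) + 1"
  have G: "0 \<le> G2" "G2 < G1" "G1 < G0"
    using gap_nonneg[OF fin(3)] dec by (auto simp: G0_def G1_def G2_def)
  have q: "1 \<le> q" by (simp add: q_def)
  have "G1 \<le> \<nu>\<^sup>2 / q\<^sup>2 * G0"
    using prev by (simp add: valid_call_def G0_def G1_def q_def)
  hence "G1 / G0 \<le> \<nu>\<^sup>2 / q\<^sup>2"
    using G by (subst pos_divide_le_eq) auto
  moreover have "(G1 - G2) / (G0 - G2) \<le> G1 / G0"
  proof -
    have "(G1 - G2) * G0 \<le> G1 * (G0 - G2)"
      using G by (simp add: algebra_simps mult_right_mono)
    thus ?thesis using G by (simp add: divide_simps)
  qed
  ultimately have "(G1 - G2) / (G0 - G2) \<le> (\<nu> / q)\<^sup>2"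
    by (simp add: power_divide)
  hence "restart_s f r j \<le> \<nu> / q"
    unfolding restart_s_eq[OF fin \<open>2 \<le> j\<close>] G0_def[symmetric] G1_def[symmetric] G2_def[symmetric]
    using nu_ge q by (intro real_le_lsqrt) auto
  hence "restart_s f r j * q \<le> \<nu>"
    using q by (simp add: pos_le_divide_eq)
  moreover have "0 \<le> restart_s f r j"
    using G unfolding restart_s_eq[OF fin \<open>2 \<le> j\<close>]
    by (simp add: G0_def G1_def G2_def)
  ultimately show ?thesis by (simp add: q_def algebra_simps)
qed

lemma restart_body_valid:
  assumes run: "valid_run r0 \<epsilon> S" and r0: "f r0 \<le> ereal (c + \<rho>)" and "0 < \<epsilon>"
    and cont: "0 \<le> idx S \<Longrightarrow> \<epsilon> < gap (point S (idx S)) - gap (point S (idx S + 1))"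
  obtains S' where "restart_body f A S = Some S'" "valid_run r0 \<epsilon> S'" "idx S' = idx S + 1"
    "point S' (idx S') = point S (idx S + 1)"
proof -
  define j where "j = idx S + 1"
  define r where "r = point S"
  define m where "m = call_iters S"
  define n where "n = max (real (m j)) (4 * restart_s f r j * real (m (j-1)))"
  have j0: "0 \<le> j" using run by (simp add: valid_run_def j_def)
  have level: "f (r i) \<le> ereal (c + \<rho>)" if "0 \<le> i" "i \<le> j" for i
  proof -
    have "f (r i) \<le> f r0" using run that by (simp add: valid_run_def j_def r_def)
    thus ?thesis using r0 by (rule order_trans)
  qed
  have valid: "valid_call r m i" if "0 \<le> i" "i < j" for i
    using run that by (simp add: valid_run_def j_def r_def m_def)
  have dec: "\<epsilon> < gap (r i) - gap (r (i+1))" if "0 \<le> i" "i < j" for i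
    using run that cont by (cases "i = idx S") (auto simp: valid_run_def j_def r_def)
  have "real (m j) \<le> real_of_int \<lceil>4 * \<nu>\<rceil>"
  proof (cases "j = 0")
    case True
    have "1 \<le> \<lceil>4 * \<nu>\<rceil>" using nu_ge by linarith
    thus ?thesis using True run by (simp add: valid_run_def m_def)
  next
    case False
    have "int (m j) \<le> \<lceil>4 * \<nu>\<rceil>"
      using valid[of "j-1"] False j0 by (simp add: valid_call_def)
    thus ?thesis by (metis of_int_le_iff of_int_of_nat_eq)
  qed
  moreover have "4 * restart_s f r j * real (m (j-1)) \<le> real_of_int \<lceil>4 * \<nu>\<rceil>"
  proof (cases "2 \<le> j")
    case True
    have "4 * restart_s f r j * real (m (j-1)) \<le> 4 * \<nu>"
      using True level valid dec[of "j-2"] dec[of "j-1"] \<open>0 < \<epsilon>\<close>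
      by (intro restart_s_bound[where y = "c + \<rho>"]) auto
    thus ?thesis by linarith
  next
    case False
    thus ?thesis using nu_ge by (simp add: restart_s_def)
  qed
  ultimately have n: "n \<le> real_of_int \<lceil>4 * \<nu>\<rceil>" by (simp add: n_def)
  obtain z' m' where call: "delayed_alg f A (r j) n = Some (z', m')" "1 \<le> m'" "n \<le> real m'"
    "int m' \<le> \<lceil>4 * \<nu>\<rceil>" "f z' \<le> f (r j)" "gap z' \<le> \<nu>\<^sup>2 / (real m' + 1)\<^sup>2 * gap (r j)"
    using delayed_alg_terminates[OF level[OF j0 order_refl] n] by blast
  define S' where "S' = \<lparr>idx = j, total_iters = total_iters S + m',
    point = r(j+1 := z'), call_iters = m(j+1 := m')\<rparr>"
  have "restart_body f A S = Some S'"
    using call(1) by (simp add: restart_body_def Let_def S'_def j_def r_def m_def n_def)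
  moreover have "valid_run r0 \<epsilon> S'"
    unfolding valid_run_def
  proof (intro conjI ballI)
    fix i assume "i \<in> {0..idx S'}"
    hence i: "0 \<le> i" "i \<le> j" by (auto simp: S'_def)
    show "valid_call (point S') (call_iters S') i"
    proof (cases "i = j")
      case True
      have "restart_s f (r(j+1 := z')) j = restart_s f r j"
        by (simp add: restart_s_def)
      thus ?thesis
        using call True by (simp add: valid_call_def S'_def n_def)
    next
      case False
      thus ?thesis using i valid by (simp add: S'_def valid_call_upd)
    qed
  next
    fix i assume "i \<in> {0..idx S' + 1}"
    hence i: "0 \<le> i" "i \<le> j + 1" by (auto simp: S'_def)
    have old: "f (r i) \<le> f r0" if "0 \<le> i" "i \<le> j" for i
      using run that by (simp add: valid_run_def j_def r_def)
    show "f (point S' i) \<le> f r0"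
    proof (cases "i = j + 1")
      case True
      thus ?thesis using call(5) old[of j] j0 by (simp add: S'_def order_trans)
    next
      case False
      thus ?thesis using i old by (simp add: S'_def)
    qed
  next
    fix i assume "i \<in> {0..<idx S'}"
    thus "\<epsilon> < gap (point S' i) - gap (point S' (i+1))"
      using dec by (simp add: S'_def)
  next
    have "{0..j} = insert j {0..idx S}" using j0 by (auto simp: j_def)
    moreover have "(\<Sum>i\<in>{0..idx S}. (m(j+1 := m')) (i+1)) = (\<Sum>i\<in>{0..idx S}. m (i+1))"
      by (intro sum.cong) (auto simp: j_def)
    ultimately show "total_iters S' = (\<Sum>i\<in>{0..idx S'}. call_iters S' (i+1))"
      using run by (simp add: S'_def valid_run_def j_def m_def)
  qed (use run j0 in \<open>auto simp: valid_run_def S'_def r_def m_def\<close>)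
  ultimately show ?thesis
    by (rule that) (simp_all add: S'_def j_def r_def)
qed

text \<open>The induction variable \<open>k\<close> bounds the remaining gap in units of \<open>\<epsilon>\<close>; a pass that does not exit
  uses up one unit.\<close>

lemma restart_loop_terminates:
  assumes "valid_run r0 \<epsilon> S" and r0: "f r0 \<le> ereal (c + \<rho>)" and eps: "0 < \<epsilon>"
    and "0 \<le> idx S \<Longrightarrow> \<epsilon> < gap (point S (idx S)) - gap (point S (idx S + 1))"
    and "gap (point S (idx S + 1)) < real k * \<epsilon>"
  shows "\<exists>S'. restart_loop f A \<epsilon> S = Some S' \<and> valid_run r0 \<epsilon> S' \<and> 0 \<le> idx S'
    \<and> restart_exit f \<epsilon> S'"
  using assms(1,4,5)
proof (induction k arbitrary: S)
  case 0
  have "f (point S (idx S + 1)) \<le> f r0"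
    using 0(1) by (simp add: valid_run_def)
  hence "0 \<le> gap (point S (idx S + 1))"
    using gap_nonneg order_trans[OF _ r0] by blast
  with 0 show ?case by simp
next
  case (Suc k)
  obtain S' where S': "restart_body f A S = Some S'" "valid_run r0 \<epsilon> S'" "idx S' = idx S + 1"
    "point S' (idx S') = point S (idx S + 1)"
    using restart_body_valid[OF Suc.prems(1) r0 eps] Suc.prems(2) by blast
  have idx: "0 \<le> idx S'" using Suc.prems(1) S'(3) by (simp add: valid_run_def)
  show ?case
  proof (cases "restart_exit f \<epsilon> S'")
    case True
    thus ?thesis
      using S' idx by (subst restart_loop.simps) simp
  next
    case False
    have "f (point S' i) \<le> ereal (c + \<rho>)" if "i \<in> {idx S', idx S' + 1}" for i
    proof -
      have "f (point S' i) \<le> f r0" using S'(2) idx that by (auto simp: valid_run_def)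
      thus ?thesis using r0 by (rule order_trans)
    qed
    hence "f (point S' i) = ereal (c + gap (point S' i))" if "i \<in> {idx S', idx S' + 1}" for i
      using that value_eq by blast
    hence dec: "\<epsilon> < gap (point S' (idx S')) - gap (point S' (idx S' + 1))"
      using False by (simp add: restart_exit_def)
    have "gap (point S' (idx S' + 1)) < real k * \<epsilon>"
      using dec Suc.prems(3) S'(4) by (simp add: algebra_simps)
    from Suc.IH[OF S'(2) dec this] show ?thesis
      using S'(1) False by (subst restart_loop.simps) simp
  qed
qed

lemma valid_run_total:
  assumes run: "valid_run r0 \<epsilon> S" and r0: "f r0 \<le> ereal (c + \<rho>)" and eps: "0 < \<epsilon>"
    and idx: "0 \<le> idx S"
  shows "real (total_iters S) \<le> exp 1 * real_of_int \<lceil>4 * \<nu>\<rceil> / 2 *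
    real_of_int \<lceil>5 + 1 / ln 15 * ln (1 + gap r0 / \<epsilon>)\<rceil>"
proof -
  define J where "J = nat (idx S)"
  define h where "h j = real (call_iters S (int j + 1))" for j
  define x where "x j = gap (point S (int j)) - gap (point S (int j + 1))" for j
  have J: "idx S = int J" using idx by (simp add: J_def)
  have le0: "f (point S (int j)) \<le> f r0" if "j \<le> J + 1" for j
    using run that by (simp add: valid_run_def J)
  have level: "f (point S (int j)) \<le> ereal (c + \<rho>)" if "j \<le> J + 1" for j
    using le0[OF that] r0 by (rule order_trans)
  have valid: "valid_call (point S) (call_iters S) (int j)" if "j \<le> J" for j
    using run that by (simp add: valid_run_def J)
  have x_gt: "\<epsilon> < x j" if "j < J" for j
    using run that by (simp add: valid_run_def J x_def)
  have "total_iters S = (\<Sum>j\<in>{0..int J}. call_iters S (j+1))"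
    using run by (simp add: valid_run_def J)
  also have "\<dots> = (\<Sum>j\<le>J. call_iters S (int j + 1))"
    by (rule sum.reindex_bij_witness[of _ int nat]) auto
  finally have "real (total_iters S) = (\<Sum>j\<le>J. h j)" by (simp add: h_def)
  also have "\<dots> \<le> exp 1 * real_of_int \<lceil>4 * \<nu>\<rceil> / 2 *
    real_of_int \<lceil>5 + 1 / ln 15 * ln (1 + gap r0 / \<epsilon>)\<rceil>"
  proof (rule iteration_sum_bound[where x = x])
    fix j assume "j < J"
    thus "h j \<le> h (Suc j)" using valid[of "Suc j"] by (simp add: valid_call_def h_def add_ac)
  next
    fix j assume "j \<le> J"
    thus "0 < h j" using valid[of j] by (simp add: valid_call_def h_def)
  next
    fix j assume "j \<le> J"
    hence "int (call_iters S (int j + 1)) \<le> \<lceil>4 * \<nu>\<rceil>"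
      using valid[of j] by (simp add: valid_call_def)
    thus "h j \<le> real_of_int \<lceil>4 * \<nu>\<rceil>"
      unfolding h_def by (metis of_int_le_iff of_int_of_nat_eq)
  next
    fix j assume j: "j + 2 \<le> J"
    define s where "s = restart_s f (point S) (int (j + 2))"
    have xp: "0 < x j" "0 < x (Suc j)" using x_gt[of j] x_gt[of "Suc j"] j eps by auto
    have s: "s = sqrt (x (Suc j) / (x j + x (Suc j)))"
      using restart_s_eq[of "point S" "int (j + 2)" "c + \<rho>"] level[of j] level[of "Suc j"]
        level[of "j + 2"] j
      by (simp add: s_def x_def algebra_simps)
    have "4 * s * h j \<le> h (j + 2)"
      using valid[OF j] by (simp add: valid_call_def h_def s_def algebra_simps)
    hence "(4 * s * h j)\<^sup>2 \<le> (h (j + 2))\<^sup>2"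
      using xp by (intro power_mono) (auto simp: s h_def)
    hence "16 * (x (Suc j) / (x j + x (Suc j))) * (h j)\<^sup>2 \<le> (h (j + 2))\<^sup>2"
      using xp by (simp add: power_mult_distrib s)
    thus "16 * x (Suc j) * (h j)\<^sup>2 \<le> (h (j + 2))\<^sup>2 * (x j + x (Suc j))"
      using xp by (simp add: field_simps)
  next
    fix j assume j: "j \<le> J"
    have "gap (point S (int j)) \<le> gap r0"
      using le0[of j] value_eq[OF level[of j]] value_eq[OF r0] j by simp
    moreover have "0 \<le> gap (point S (int j + 1))"
      using gap_nonneg[OF level[of "Suc j"]] j by (simp add: add_ac)
    ultimately show "x j \<le> gap r0" by (simp add: x_def)
  qed (use x_gt eps gap_nonneg[OF r0] in auto)
  finally show ?thesis .
qed

theorem restart_alg_bounds: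
  assumes r0: "f r0 \<le> ereal (c + \<rho>)" and eps: "0 < \<epsilon>"
  shows "\<exists>S. restart_alg f A \<epsilon> r0 = Some S \<and>
    (\<forall>j\<in>{0..idx S}. int (call_iters S (j + 1)) \<le> \<lceil>4 * \<nu>\<rceil>) \<and>
    f (point S (idx S)) - f (point S (idx S + 1)) \<le> ereal \<epsilon> \<and>
    total_iters S = (\<Sum>j\<in>{0..idx S}. call_iters S (j + 1)) \<and>
    real (total_iters S) \<le> exp 1 * real_of_int \<lceil>4 * \<nu>\<rceil> / 2 *
      real_of_int \<lceil>5 + 1 / ln 15 * ln (1 + gap r0 / \<epsilon>)\<rceil>"
proof -
  have init: "valid_run r0 \<epsilon> (restart_init r0)"
    by (simp add: valid_run_def restart_init_def)
  obtain k where "gap r0 < real k * \<epsilon>"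
    using reals_Archimedean3[OF eps] by blast
  then obtain S where S: "restart_alg f A \<epsilon> r0 = Some S" "valid_run r0 \<epsilon> S" "0 \<le> idx S"
    "restart_exit f \<epsilon> S"
    using restart_loop_terminates[OF init r0 eps, of k]
    by (auto simp: restart_alg_def restart_init_def)
  moreover from S(2) have "\<forall>j\<in>{0..idx S}. int (call_iters S (j + 1)) \<le> \<lceil>4 * \<nu>\<rceil>"
    by (auto simp: valid_run_def valid_call_def)
  ultimately show ?thesis
    using valid_run_total[OF S(2) r0 eps S(3)]
    by (auto simp: restart_exit_def valid_run_def)
qed

end

section \<open>The rate from quadratic growth\<close>

lemma opt_val_finite:
  assumes "proper_fun f" "minimizers f \<noteq> {}"
  obtains c where "opt_val f = ereal c" "\<And>z. ereal c \<le> f z"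
proof -
  obtain z where z: "\<And>y. f z \<le> f y" using assms(2) by (auto simp: minimizers_def)
  obtain y where "f y \<noteq> \<infinity>" using assms(1) by (auto simp: proper_fun_def)
  with z[of y] have "f z \<noteq> \<infinity>" by auto
  moreover have "f z \<noteq> -\<infinity>" using assms(1) by (simp add: proper_fun_def)
  moreover have "opt_val f = f z"
    unfolding opt_val_def using z by (intro antisym INF_lower INF_greatest) auto
  ultimately show ?thesis using that[of "real_of_ereal (f z)"] z by (cases "f z") auto
qed

text \<open>On the sublevel set \<open>a d\<^sup>2 \<le> (2a / \<mu>\<^sub>\<rho>) (f z - f*) \<le> n\<^sub>\<rho>\<^sup>2 (f z - f*)\<close>, where \<open>d\<close> is the distance of \<open>z\<close> to
  its projection onto the minimizers.\<close>

lemma sublevel_rate_of_growth: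
  assumes c: "opt_val f = ereal c" "\<And>z. ereal c \<le> f z"
    and growth: "quadratic_growth N f \<mu>" and alg: "algorithm_assumption N f A g a L"
    and rho: "\<rho> \<ge> 0"
  shows "sublevel_rate f A c (n_bound a \<mu> \<rho>) \<rho>"
proof
  fix z and k :: nat
  assume z: "f z \<le> ereal (c + \<rho>)" and k: "1 \<le> k"
  define d where "d = dist_opt N f z"
  obtain v where v: "f z = ereal v" "v \<le> c + \<rho>"
    using z c(2)[of z] by (cases "f z") auto
  have mu: "0 < \<mu> \<rho>" and a: "0 < a"
    using growth alg rho by (auto simp: quadratic_growth_def algorithm_assumption_def)
  have "z \<in> sublevel f \<rho>" using v c by (simp add: sublevel_def)
  with growth rho have "ereal (\<mu> \<rho> / 2 * d\<^sup>2) \<le> f z - opt_val f"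
    by (auto simp: quadratic_growth_def d_def)
  hence "\<mu> \<rho> / 2 * d\<^sup>2 \<le> v - c" using v c by simp
  hence "2 * a / \<mu> \<rho> * (\<mu> \<rho> / 2 * d\<^sup>2) \<le> 2 * a / \<mu> \<rho> * (v - c)"
    using mu a by (intro mult_left_mono) auto
  hence "a * d\<^sup>2 \<le> 2 * a / \<mu> \<rho> * (v - c)"
    using mu by simp
  also have "\<dots> \<le> (n_bound a \<mu> \<rho>)\<^sup>2 * (v - c)"
  proof (rule mult_right_mono)
    have "(sqrt (2 * a / \<mu> \<rho>))\<^sup>2 \<le> (n_bound a \<mu> \<rho>)\<^sup>2"
      using mu a by (intro power_mono) (auto simp: n_bound_def)
    thus "2 * a / \<mu> \<rho> \<le> (n_bound a \<mu> \<rho>)\<^sup>2" using mu a by simp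
    show "0 \<le> v - c" using c(2)[of z] v by simp
  qed
  finally have d: "a / (real k + 1)\<^sup>2 * d\<^sup>2 \<le> (n_bound a \<mu> \<rho>)\<^sup>2 / (real k + 1)\<^sup>2 * (v - c)"
    by (simp add: divide_right_mono)
  have "z \<in> eff_dom f" using v by (simp add: eff_dom_def)
  with alg k have "f (A k z) - opt_val f \<le> ereal (a / (real k + 1)\<^sup>2 * d\<^sup>2)"
    by (auto simp: algorithm_assumption_def d_def)
  with d show "f (A k z) \<le> ereal (c + (n_bound a \<mu> \<rho>)\<^sup>2 / (real k + 1)\<^sup>2 * (real_of_ereal (f z) - c))"
    using v c by (cases "f (A k z)") auto
qed (use c in \<open>auto simp: n_bound_def\<close>)

theorem theorem3p33:
  fixes f :: "real ^ 'n \<Rightarrow> ereal"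
    and N :: "real ^ 'n \<Rightarrow> real"
    and A :: "nat \<Rightarrow> real ^ 'n \<Rightarrow> real ^ 'n"
    and g :: "real ^ 'n \<Rightarrow> real ^ 'n"
    and a L \<rho> \<epsilon> :: real
    and \<mu> :: "real \<Rightarrow> real"
    and r0 :: "real ^ 'n"
  assumes "is_norm N"
    and "proper_fun f" and "closed_fun f" and "convex_fun f"
    and "minimizers f \<noteq> {}"
    and "quadratic_growth N f \<mu>"
    and "algorithm_assumption N f A g a L"
    and "\<rho> \<ge> 0" and "r0 \<in> sublevel f \<rho>"
    and "\<epsilon> > 0"
  shows "\<exists>S. restart_alg f A \<epsilon> r0 = Some S \<and>
    (\<forall>j\<in>{0..idx S}. int (call_iters S (j + 1)) \<le> \<lceil>4 * n_bound a \<mu> \<rho>\<rceil>) \<and>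
    f (point S (idx S)) - f (point S (idx S + 1)) \<le> ereal \<epsilon> \<and>
    total_iters S = (\<Sum>j\<in>{0..idx S}. call_iters S (j + 1)) \<and>
    real (total_iters S) \<le> exp 1 * real_of_int \<lceil>4 * n_bound a \<mu> \<rho>\<rceil> / 2 *
      real_of_int \<lceil>5 + 1 / ln 15 * ln (1 + real_of_ereal (f r0 - opt_val f) / \<epsilon>)\<rceil>"
proof -
  obtain c where c: "opt_val f = ereal c" "\<And>z. ereal c \<le> f z"
    using opt_val_finite assms by blast
  interpret sublevel_rate f A c "n_bound a \<mu> \<rho>" \<rho>
    by (rule sublevel_rate_of_growth[OF c]) (use assms in auto)
  have r0: "f r0 \<le> ereal (c + \<rho>)"
    using assms(9) c(1) c(2)[of r0] by (cases "f r0") (auto simp: sublevel_def)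
  have "real_of_ereal (f r0 - opt_val f) = gap r0"
    using value_eq[OF r0] c(1) by simp
  with restart_alg_bounds[OF r0 \<open>\<epsilon> > 0\<close>] show ?thesis by simp
qed

end
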